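(* Let $\rho\in(0,2]$, $\nu\in[0,1]$, $\alpha=\sqrt{8\rho^{-1}-4}$, $\beta=2\rho^{-1}-2$, and let $X\in\mathbb{B}(\mathcal{H})$. Then $$\Delta_{(\rho,\nu)}(X)\leq\frac{1+|1-2\nu|}{2}\left(\left\|\begin{bmatrix}0&\alpha X\\0&\beta X\end{bmatrix}\right\|+w\left(\widetilde{\begin{bmatrix}0&\alpha X\\0&\beta X\end{bmatrix}}\right)\right).$$
   Context: $\mathbb{B}(\mathcal{H})$ is the $C^*$-algebra of bounded linear operators on a complex Hilbert space $\mathcal{H}$, and $\|\cdot\|$ is the operator norm. For a bounded operator $A$ on a complex Hilbert space, $w(A)=\sup_{\|z\|=1}|\langle Az,z\rangle|$ is the numerical radius, and $|A|=(A^*A)^{1/2}$. If $A=V|A|$ is the polar decomposition of $A$ ($V$ a partial isometry with $V^*V|A|=|A|$), the Aluthge transform of $A$ is $\widetilde{A}=|A|^{1/2}V|A|^{1/2}$. For $\rho\in(0,2]$, $\nu\in[0,1]$, $\alpha=\sqrt{8\rho^{-1}-4}$, $\beta=2\rho^{-1}-2$ and $X\in\mathbb{B}(\mathcal{H})$ define $$\Delta_{(\rho,\nu)}(X)=w\left(\begin{bmatrix}0&\alpha X\\ \alpha(1-2\nu)X^*&\beta\left(X+(1-2\nu)X^*\right)\end{bmatrix}\right).$$ All $2\times2$ operator matrices act on $\mathcal{H}\oplus\mathcal{H}$. *)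

theory Defs
  imports "HOL-Analysis.Analysis"
begin

text \<open>
  The library has real inner product spaces only. A complex inner product space is a real one whose
  real structure is the restriction of the complex one. The product type carries the \<open>\<ell>\<^sup>2\<close> norm, so
  that it is the Hilbert space direct sum. The complex inner product is linear in its first argument.
\<close>

class complex_inner = real_inner +
  fixes scaleC :: "complex \<Rightarrow> 'a \<Rightarrow> 'a" (infixr "*\<^sub>C" 75)
    and cinner :: "'a \<Rightarrow> 'a \<Rightarrow> complex"
  assumes scaleC_add_right: "c *\<^sub>C (x + y) = c *\<^sub>C x + c *\<^sub>C y"
    and scaleC_add_left: "(c + d) *\<^sub>C x = c *\<^sub>C x + d *\<^sub>C x"
    and scaleC_scaleC: "c *\<^sub>C d *\<^sub>C x = (c * d) *\<^sub>C x"
    and scaleC_of_real: "complex_of_real r *\<^sub>C x = r *\<^sub>R x"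
    and cinner_add_left: "cinner (x + y) z = cinner x z + cinner y z"
    and cinner_scaleC_left: "cinner (c *\<^sub>C x) y = c * cinner x y"
    and cinner_commute: "cinner x y = cnj (cinner y x)"
    and Re_cinner: "Re (cinner x y) = x \<bullet> y"

class chilbert_space = complex_inner + complete_space

lemma cinner_self:
  fixes x :: "'a :: complex_inner"
  shows "cinner x x = complex_of_real ((norm x)\<^sup>2)"
proof -
  have "Im (cinner x x) = - Im (cinner x x)"
    by (subst cinner_commute) simp
  then show ?thesis
    by (simp add: complex_eq_iff Re_cinner power2_norm_eq_inner)
qed

instantiation complex :: chilbert_space
begin

definition scaleC_complex :: "complex \<Rightarrow> complex \<Rightarrow> complex"
  where "scaleC_complex c x = c * x"

definition cinner_complex :: "complex \<Rightarrow> complex \<Rightarrow> complex"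
  where "cinner_complex x y = x * cnj y"

instance
  by standard
    (simp_all add: scaleC_complex_def cinner_complex_def inner_complex_def scaleR_conv_of_real
      algebra_simps)

end

instantiation prod :: (complex_inner, complex_inner) complex_inner
begin

definition scaleC_prod :: "complex \<Rightarrow> 'a \<times> 'b \<Rightarrow> 'a \<times> 'b"
  where "scaleC_prod c z = (c *\<^sub>C fst z, c *\<^sub>C snd z)"

definition cinner_prod :: "'a \<times> 'b \<Rightarrow> 'a \<times> 'b \<Rightarrow> complex"
  where "cinner_prod z w = cinner (fst z) (fst w) + cinner (snd z) (snd w)"

instance
proof
  fix x y :: "'a \<times> 'b"
  show "cinner x y = cnj (cinner y x)"
    by (simp add: cinner_prod_def cinner_commute[of "fst x"] cinner_commute[of "snd x"])
qed (simp_all add: scaleC_prod_def cinner_prod_def inner_prod_def prod_eq_iff scaleC_add_right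
      scaleC_add_left scaleC_scaleC scaleC_of_real cinner_add_left cinner_scaleC_left Re_cinner
      algebra_simps)

end

instance prod :: (chilbert_space, chilbert_space) chilbert_space ..

text \<open>
  Operators are functions subject to the predicate below; their operator norm is \<^const>\<open>onorm\<close>.
\<close>

definition bounded_clinear :: "('a :: complex_inner \<Rightarrow> 'b :: complex_inner) \<Rightarrow> bool"
  where "bounded_clinear A \<longleftrightarrow> bounded_linear A \<and> (\<forall>c x. A (c *\<^sub>C x) = c *\<^sub>C A x)"

definition cadjoint :: "('a :: chilbert_space \<Rightarrow> 'b :: chilbert_space) \<Rightarrow> 'b \<Rightarrow> 'a"
  where "cadjoint A = (THE B. bounded_clinear B \<and> (\<forall>x y. cinner (A x) y = cinner x (B y)))"

text \<open>
  Inserting 0 only matters on the zero space, where there are no unit vectors: the supremum of the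
  empty set of real numbers is unspecified in HOL, and is taken to be 0 here.
\<close>

definition numerical_radius :: "('a :: chilbert_space \<Rightarrow> 'a) \<Rightarrow> real"
  where "numerical_radius A = Sup (insert 0 {cmod (cinner (A z) z) | z. norm z = 1})"

definition positive_op :: "('a :: chilbert_space \<Rightarrow> 'a) \<Rightarrow> bool"
  where "positive_op A \<longleftrightarrow> bounded_clinear A \<and> (\<forall>x. cinner (A x) x \<in> \<real>\<^sub>\<ge>\<^sub>0)"

definition sqrt_op :: "('a :: chilbert_space \<Rightarrow> 'a) \<Rightarrow> 'a \<Rightarrow> 'a"
  where "sqrt_op A = (THE S. positive_op S \<and> S \<circ> S = A)"

definition abs_op :: "('a :: chilbert_space \<Rightarrow> 'a) \<Rightarrow> 'a \<Rightarrow> 'a"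
  where "abs_op A = sqrt_op (cadjoint A \<circ> A)"

definition partial_isometry :: "('a :: chilbert_space \<Rightarrow> 'a) \<Rightarrow> bool"
  where "partial_isometry V \<longleftrightarrow> bounded_clinear V \<and>
    (\<forall>x. (\<forall>k. V k = 0 \<longrightarrow> cinner x k = 0) \<longrightarrow> norm (V x) = norm x)"

definition polar_decomposition :: "('a :: chilbert_space \<Rightarrow> 'a) \<Rightarrow> ('a \<Rightarrow> 'a) \<Rightarrow> bool"
  where "polar_decomposition A V \<longleftrightarrow> partial_isometry V \<and> A = V \<circ> abs_op A \<and>
    cadjoint V \<circ> V \<circ> abs_op A = abs_op A"

text \<open>
  The partial isometry in \<^const>\<open>polar_decomposition\<close> need not be unique, since its kernel may be
  smaller than that of \<open>A\<close>. The Aluthge transform does not depend on the choice: two such partial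
  isometries agree on the closure of the range of \<open>\<bar>A\<bar>\<close>, which contains the range of \<open>\<bar>A\<bar>\<^sup>1\<^sup>/\<^sup>2\<close>.
\<close>

definition aluthge :: "('a :: chilbert_space \<Rightarrow> 'a) \<Rightarrow> 'a \<Rightarrow> 'a"
  where "aluthge A = (THE B. \<exists>V. polar_decomposition A V \<and>
    B = sqrt_op (abs_op A) \<circ> V \<circ> sqrt_op (abs_op A))"

definition op_matrix ::
    "('a :: chilbert_space \<Rightarrow> 'a) \<Rightarrow> ('a \<Rightarrow> 'a) \<Rightarrow> ('a \<Rightarrow> 'a) \<Rightarrow> ('a \<Rightarrow> 'a) \<Rightarrow> 'a \<times> 'a \<Rightarrow> 'a \<times> 'a"
  where "op_matrix A B C D = (\<lambda>(x, y). (A x + B y, C x + D y))"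

definition Delta :: "real \<Rightarrow> real \<Rightarrow> ('a :: chilbert_space \<Rightarrow> 'a) \<Rightarrow> real"
  where "Delta \<rho> \<nu> X =
    (let \<alpha> = sqrt (8 * inverse \<rho> - 4); \<beta> = 2 * inverse \<rho> - 2 in
      numerical_radius
        (op_matrix
          (\<lambda>x. 0)                                     (\<lambda>x. \<alpha> *\<^sub>R X x)
          (\<lambda>x. (\<alpha> * (1 - 2 * \<nu>)) *\<^sub>R cadjoint X x)     (\<lambda>x. \<beta> *\<^sub>R (X x + (1 - 2 * \<nu>) *\<^sub>R cadjoint X x))))"

end

theory Submission
  imports Defs
begin

text \<open>
  The operator matrix in \<open>\<Delta>\<close> is \<open>T + (1 - 2 \<nu>) T\<^sup>*\<close> with \<open>T\<close> the matrix on the right-hand side, and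
  \<open>\<langle>T\<^sup>* z, z\<rangle>\<close> is the conjugate of \<open>\<langle>T z, z\<rangle>\<close>. Hence its numerical radius is at most
  \<open>(1 + \<bar>1 - 2 \<nu>\<bar>) w(T)\<close>, and Yamazaki's inequality bounds \<open>w(T)\<close> by half the sum of \<open>\<parallel>T\<parallel>\<close> and the
  numerical radius of the Aluthge transform of \<open>T\<close>.
\<close>

\<comment> \<open>The adjoint, the square root and the Aluthge transform are definite descriptions:
  nothing can be said about any of them until existence and uniqueness are settled, and most of the
  development serves this end. Projections and the Riesz theorem live in the underlying real Hilbert
  space; complex statements are recovered by rotating vectors by \<open>\<i>\<close> or by a
  unimodular scalar. The square root comes from an iteration rather than from spectral theory. The
  iteration also shows that the root commutes with whatever commutes with the operator, and
  uniqueness rests on that.\<close>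
subclass (in chilbert_space) banach ..

section \<open>The complex inner product\<close>

lemma cinner_add_right: "cinner x (y + z) = cinner x y + cinner x z"
  by (metis cinner_add_left cinner_commute complex_cnj_add)

lemma cinner_scaleC_right: "cinner x (c *\<^sub>C y) = cnj c * cinner x y"
  by (metis cinner_scaleC_left cinner_commute complex_cnj_mult)

lemma norm_scaleC: "norm (c *\<^sub>C x) = cmod c * norm x"
proof -
  have "complex_of_real ((norm (c *\<^sub>C x))\<^sup>2) = complex_of_real ((cmod c * norm x)\<^sup>2)"
    unfolding cinner_self[symmetric] cinner_scaleC_left cinner_scaleC_right
    by (simp add: cinner_self complex_norm_square power_mult_distrib del: of_real_power)
  then show ?thesis
    by (simp add: power2_eq_iff_nonneg del: of_real_power)
qed

text \<open>The unimodular \<open>c\<close> rotates \<open>cinner x y\<close> onto its modulus, so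
  the real Cauchy-Schwarz inequality for \<open>c *\<^sub>C x\<close> and \<open>y\<close> gives the
  complex one.\<close>

lemma cmod_cinner_le: "cmod (cinner x y) \<le> norm x * norm y"
proof (cases "cinner x y = 0")
  case False
  define c where "c = cnj (cinner x y) / cmod (cinner x y)"
  have c: "cmod c = 1"
    using False by (simp add: c_def norm_divide)
  have "c * cinner x y = complex_of_real ((cmod (cinner x y))\<^sup>2) / cmod (cinner x y)"
    unfolding c_def by (simp add: complex_norm_square mult.commute del: of_real_power)
  then have "c * cinner x y = complex_of_real (cmod (cinner x y))"
    using False by (simp add: power2_eq_square)
  then have "cmod (cinner x y) = (c *\<^sub>C x) \<bullet> y"
    by (metis Re_complex_of_real Re_cinner cinner_scaleC_left)
  also have "\<dots> \<le> norm (c *\<^sub>C x) * norm y"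
    by (rule norm_cauchy_schwarz)
  finally show ?thesis
    by (simp add: norm_scaleC c)
qed simp

lemma bounded_bilinear_cinner: "bounded_bilinear cinner"
proof
  show "cinner (r *\<^sub>R x) y = r *\<^sub>R cinner x y" for r and x y :: 'a
    by (metis cinner_scaleC_left scaleC_of_real scaleR_conv_of_real)
  show "cinner x (r *\<^sub>R y) = r *\<^sub>R cinner x y" for r and x y :: 'a
    by (metis cinner_scaleC_right complex_cnj_complex_of_real scaleC_of_real scaleR_conv_of_real)
  show "\<exists>K. \<forall>x y :: 'a. norm (cinner x y) \<le> norm x * norm y * K"
    by (rule exI[of _ 1]) (simp add: cmod_cinner_le)
qed (simp_all add: cinner_add_left cinner_add_right)

lemmas cinner_zero_left = bounded_bilinear.zero_left[OF bounded_bilinear_cinner]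
  and cinner_zero_right = bounded_bilinear.zero_right[OF bounded_bilinear_cinner]
  and cinner_diff_left = bounded_bilinear.diff_left[OF bounded_bilinear_cinner]
  and cinner_diff_right = bounded_bilinear.diff_right[OF bounded_bilinear_cinner]
  and cinner_scaleR_left = bounded_bilinear.scaleR_left[OF bounded_bilinear_cinner]
  and cinner_scaleR_right = bounded_bilinear.scaleR_right[OF bounded_bilinear_cinner]
  and tendsto_cinner = bounded_bilinear.tendsto[OF bounded_bilinear_cinner]

lemma cinner_ext:
  assumes "\<And>y. cinner x y = cinner x' y"
  shows "x = x'"
  using assms[of "x - x'"] cinner_self[of "x - x'"] by (simp add: cinner_diff_left)

lemma bounded_linear_scaleC: "bounded_linear (\<lambda>x. c *\<^sub>C x)"
proof (rule bounded_linear_intro)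
  show "c *\<^sub>C r *\<^sub>R x = r *\<^sub>R c *\<^sub>C x" for r x
    by (metis mult.commute scaleC_of_real scaleC_scaleC)
  show "norm (c *\<^sub>C x) \<le> norm x * cmod c" for x
    by (simp add: norm_scaleC)
qed (rule scaleC_add_right)

text \<open>Lifts orthogonality from the real to the complex inner product: real orthogonality to
  both \<open>y\<close> and \<open>\<i> *\<^sub>C y\<close> suffices.\<close>

lemma cinner_Im: "Im (cinner x y) = Re (cinner x (\<i> *\<^sub>C y))"
  by (simp add: cinner_scaleC_right)

section \<open>Orthogonal projection and the adjoint\<close>

lemma subspace_closure:
  fixes S :: "'a :: real_normed_vector set"
  assumes "subspace S"
  shows "subspace (closure S)"
  unfolding subspace_def
proof (intro conjI ballI allI)
  show "0 \<in> closure S"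
    using subspace_0[OF assms] closure_subset by blast
  fix x y and c :: real
  assume "x \<in> closure S" "y \<in> closure S"
  then obtain f g where f: "\<And>n. f n \<in> S" "f \<longlonglongrightarrow> x" and g: "\<And>n. g n \<in> S" "g \<longlonglongrightarrow> y"
    unfolding closure_sequential by blast
  show "x + y \<in> closure S"
    unfolding closure_sequential
    by (intro exI[of _ "\<lambda>n. f n + g n"] conjI allI subspace_add[OF assms] tendsto_add f g)
  show "c *\<^sub>R x \<in> closure S"
    unfolding closure_sequential
    by (intro exI[of _ "\<lambda>n. c *\<^sub>R f n"] conjI allI subspace_scale[OF assms] tendsto_scaleR
        tendsto_const f)
qed

text \<open>A sequence in \<open>S\<close> minimizing the distance to \<open>x\<close> is Cauchy,
  and minimality of its limit forces orthogonality.\<close>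

lemma orthogonal_projection_exists:
  fixes x :: "'a :: {real_inner, complete_space}"
  assumes S: "subspace S" "closed S"
  shows "\<exists>a\<in>S. \<forall>s\<in>S. (x - a) \<bullet> s = 0"
proof -
  define d where "d = (INF s\<in>S. (norm (x - s))\<^sup>2)"
  have bdd: "bdd_below ((\<lambda>s. (norm (x - s))\<^sup>2) ` S)"
    by (rule bdd_belowI[of _ 0]) auto
  have ne: "S \<noteq> {}"
    using subspace_0[OF S(1)] by auto
  have d_le: "d \<le> (norm (x - s))\<^sup>2" if "s \<in> S" for s
    unfolding d_def using bdd that by (rule cINF_lower)
  have "\<exists>s\<in>S. (norm (x - s))\<^sup>2 < d + e" if "e > 0" for e
    using cINF_less_iff[OF ne bdd, of "d + e"] that unfolding d_def by simp
  then have "\<exists>s\<in>S. (norm (x - s))\<^sup>2 < d + 1 / Suc n" for n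
    by simp
  then obtain f where fS: "\<And>n. f n \<in> S" and f: "\<And>n. (norm (x - f n))\<^sup>2 < d + 1 / Suc n"
    by metis
  \<comment> \<open>The parallelogram law for \<open>x - s\<close> and \<open>x - t\<close>; the
    midpoint of \<open>s\<close> and \<open>t\<close> lies in \<open>S\<close>, so its squared
    distance to \<open>x\<close> is at least \<open>d\<close>.\<close>
  have para: "(norm (s - t))\<^sup>2 \<le> 2 * (norm (x - s))\<^sup>2 + 2 * (norm (x - t))\<^sup>2 - 4 * d"
    if "s \<in> S" "t \<in> S" for s t
  proof -
    have "(1/2) *\<^sub>R (s + t) \<in> S"
      using S(1) that by (simp add: subspace_add subspace_scale)
    then have "d \<le> (norm (x - (1/2) *\<^sub>R (s + t)))\<^sup>2"
      by (rule d_le)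
    also have "\<dots> = (norm ((1/2) *\<^sub>R ((x - s) + (x - t))))\<^sup>2"
      by (simp add: algebra_simps flip: scaleR_left_distrib)
    also have "\<dots> = (norm ((x - s) + (x - t)))\<^sup>2 / 4"
      by (simp add: power_divide)
    finally have "4 * d \<le> (norm ((x - s) + (x - t)))\<^sup>2"
      by simp
    moreover have "(norm (s - t))\<^sup>2 = (norm ((x - s) - (x - t)))\<^sup>2"
      by (simp add: norm_minus_commute)
    ultimately show ?thesis
      by (simp add: power2_norm_eq_inner inner_add_left inner_add_right inner_diff_left
          inner_diff_right inner_commute)
  qed
  have "Cauchy f"
  proof (rule metric_CauchyI)
    fix e :: real
    assume e: "e > 0"
    obtain N where N: "1 / Suc N < e\<^sup>2 / 4"
      using nat_approx_posE[of "e\<^sup>2 / 4"] e by auto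
    have "dist (f m) (f n) < e" if "m \<ge> N" "n \<ge> N" for m n
    proof -
      have "1 / Suc m \<le> 1 / Suc N" "1 / Suc n \<le> 1 / Suc N"
        using that by (simp_all add: frac_le)
      then have "(norm (f m - f n))\<^sup>2 < e\<^sup>2"
        using para[OF fS fS, of m n] f[of m] f[of n] N by linarith
      then show ?thesis
        using e by (simp add: dist_norm power_less_imp_less_base)
    qed
    then show "\<exists>N. \<forall>m\<ge>N. \<forall>n\<ge>N. dist (f m) (f n) < e"
      by blast
  qed
  then obtain a where a: "f \<longlonglongrightarrow> a"
    by (metis Cauchy_convergent convergent_def)
  have aS: "a \<in> S"
    using closed_sequentially[OF S(2)] fS a by blast
  have "(norm (x - a))\<^sup>2 \<le> d"
  proof (rule LIMSEQ_le)
    show "(\<lambda>n. (norm (x - f n))\<^sup>2) \<longlonglongrightarrow> (norm (x - a))\<^sup>2"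
      by (intro tendsto_intros a)
    show "(\<lambda>n. d + 1 / Suc n) \<longlonglongrightarrow> d"
      using tendsto_add[OF tendsto_const LIMSEQ_inverse_real_of_nat, of d]
      by (simp add: inverse_eq_divide)
  qed (use f in \<open>auto intro!: exI[of _ 0] less_imp_le\<close>)
  then have min: "(norm (x - a))\<^sup>2 \<le> (norm (x - s))\<^sup>2" if "s \<in> S" for s
    using d_le[OF that] by linarith
  have "(x - a) \<bullet> s = 0" if s: "s \<in> S" for s
  proof (cases "s = 0")
    case False
    \<comment> \<open>This \<open>t\<close> minimizes the norm of
      \<open>(x - a) - t *\<^sub>R s\<close>.\<close>
    define t where "t = ((x - a) \<bullet> s) / (s \<bullet> s)"
    have "a + t *\<^sub>R s \<in> S"
      using S(1) aS s by (simp add: subspace_add subspace_scale)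
    then have "(norm (x - a))\<^sup>2 \<le> (norm ((x - a) - t *\<^sub>R s))\<^sup>2"
      using min by (simp add: diff_diff_eq)
    then have "2 * t * ((x - a) \<bullet> s) \<le> t * t * (s \<bullet> s)"
      unfolding power2_norm_eq_inner
      by (simp add: inner_diff_left inner_diff_right inner_commute algebra_simps)
    then have "((x - a) \<bullet> s)\<^sup>2 / (s \<bullet> s) \<le> 0"
      using False by (simp add: t_def power2_eq_square)
    moreover have "s \<bullet> s > 0"
      using False by simp
    ultimately have "((x - a) \<bullet> s)\<^sup>2 \<le> 0"
      by (metis divide_le_0_iff not_le)
    then show ?thesis
      by simp
  qed simp
  with aS show ?thesis
    by blast
qed

text \<open>For nonzero \<open>f\<close>, the representing vector is a multiple of \<open>e\<close>,
  the component of some \<open>x\<close> outside the kernel that is orthogonal to the kernel.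
  Subtracting \<open>(f y / f e) *\<^sub>R e\<close> from \<open>y\<close> lands in the kernel,
  which determines the multiple.\<close>

lemma riesz_representation:
  fixes f :: "'a :: {real_inner, complete_space} \<Rightarrow> real"
  assumes "bounded_linear f"
  shows "\<exists>y. \<forall>x. f x = x \<bullet> y"
proof (cases "\<forall>x. f x = 0")
  case True
  then show ?thesis
    by (auto intro: exI[of _ 0])
next
  case False
  interpret f: bounded_linear f
    by fact
  from False obtain x where x: "f x \<noteq> 0"
    by blast
  define S where "S = {x. f x = 0}"
  have "subspace S"
    by (auto simp: S_def subspace_def f.add f.scaleR f.zero)
  moreover have "closed S"
    unfolding S_def by (intro closed_Collect_eq continuous_intros f.continuous_on)
  ultimately obtain a where a: "a \<in> S" "\<And>s. s \<in> S \<Longrightarrow> (x - a) \<bullet> s = 0"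
    using orthogonal_projection_exists by meson
  define e where "e = x - a"
  have fe: "f e \<noteq> 0"
    using a(1) x by (simp add: e_def f.diff S_def)
  then have e: "e \<bullet> e \<noteq> 0"
    using f.zero by auto
  have "f y = y \<bullet> ((f e / (e \<bullet> e)) *\<^sub>R e)" for y
  proof -
    have "y - (f y / f e) *\<^sub>R e \<in> S"
      using fe by (simp add: S_def f.diff f.scaleR)
    then have "e \<bullet> (y - (f y / f e) *\<^sub>R e) = 0"
      unfolding e_def by (rule a(2))
    then have "y \<bullet> e = (f y / f e) * (e \<bullet> e)"
      by (simp add: inner_diff_right inner_commute)
    then show ?thesis
      using fe e by simp
  qed
  then show ?thesis
    by blast
qed

lemma bounded_clinearD:
  assumes "bounded_clinear A"
  shows "bounded_linear A" "A (c *\<^sub>C x) = c *\<^sub>C A x"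
  using assms by (simp_all add: bounded_clinear_def)

lemma bounded_clinear_compose:
  "bounded_clinear A \<Longrightarrow> bounded_clinear B \<Longrightarrow> bounded_clinear (A \<circ> B)"
  unfolding bounded_clinear_def using bounded_linear_compose[of A B] by (simp add: o_def)

text \<open>Complex linearity upgrades an adjoint relation for the real inner product to the complex one.\<close>

lemma cinner_adjoint_from_inner:
  assumes A: "bounded_clinear A" and AB: "\<And>x y. A x \<bullet> y = x \<bullet> B y"
  shows "cinner (A x) y = cinner x (B y)"
proof (rule complex_eqI)
  show "Re (cinner (A x) y) = Re (cinner x (B y))"
    by (simp add: Re_cinner AB)
  have "Re (cinner (A ((- \<i>) *\<^sub>C x)) y) = Re (cinner ((- \<i>) *\<^sub>C x) (B y))"
    by (simp only: Re_cinner AB)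
  then show "Im (cinner (A x) y) = Im (cinner x (B y))"
    by (simp add: bounded_clinearD(2)[OF A] cinner_scaleC_left)
qed

text \<open>Riesz over the reals gives \<open>B y\<close> for each \<open>y\<close> separately.
  Linearity of \<open>B\<close> follows by testing against vectors, and its bound from
  \<open>(norm (B y))\<^sup>2\<close> being the modulus of
  \<open>cinner (A (B y)) y\<close>.\<close>

lemma adjoint_exists:
  fixes A :: "'a :: chilbert_space \<Rightarrow> 'b :: chilbert_space"
  assumes A: "bounded_clinear A"
  shows "\<exists>B. bounded_clinear B \<and> (\<forall>x y. cinner (A x) y = cinner x (B y))"
proof -
  have lin: "bounded_linear A"
    using A by (rule bounded_clinearD)
  have "bounded_linear (\<lambda>x. A x \<bullet> y)" for y
    by (rule bounded_linear_compose[OF bounded_linear_inner_left lin])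
  then have "\<exists>b. \<forall>x. A x \<bullet> y = x \<bullet> b" for y
    by (rule riesz_representation)
  then obtain B where "\<And>x y. A x \<bullet> y = x \<bullet> B y"
    by metis
  then have B: "cinner (A x) y = cinner x (B y)" for x y
    by (rule cinner_adjoint_from_inner[OF A])
  then have B': "cinner (B y) x = cinner y (A x)" for x y
    by (metis cinner_commute)
  obtain K where K: "\<And>x. norm (A x) \<le> norm x * K" "K \<ge> 0"
    using bounded_linear.nonneg_bounded[OF lin] by blast
  have scaleC: "B (c *\<^sub>C y) = c *\<^sub>C B y" for c y
    by (rule cinner_ext) (simp add: B' cinner_scaleC_left)
  have "bounded_linear B"
  proof (rule bounded_linear_intro)
    show "B (x + y) = B x + B y" for x y
      by (rule cinner_ext) (simp add: B' cinner_add_left)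
    show "B (r *\<^sub>R y) = r *\<^sub>R B y" for r y
      by (metis scaleC scaleC_of_real)
    show "norm (B y) \<le> norm y * K" for y
    proof -
      have "(norm (B y))\<^sup>2 = cmod (cinner (A (B y)) y)"
        by (simp add: B cinner_self norm_power)
      also have "\<dots> \<le> norm (A (B y)) * norm y"
        by (rule cmod_cinner_le)
      also have "\<dots> \<le> norm (B y) * K * norm y"
        by (intro mult_right_mono K) simp
      finally have "norm (B y) * norm (B y) \<le> norm (B y) * (norm y * K)"
        by (simp add: power2_eq_square algebra_simps)
      then show ?thesis
        by (cases "B y = 0") (simp_all add: K)
    qed
  qed
  with scaleC B show ?thesis
    by (auto simp: bounded_clinear_def)
qed

lemma
  fixes A :: "'a :: chilbert_space \<Rightarrow> 'b :: chilbert_space"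
  assumes "bounded_clinear A"
  shows bounded_clinear_cadjoint: "bounded_clinear (cadjoint A)"
    and cinner_cadjoint: "cinner (A x) y = cinner x (cadjoint A y)"
proof -
  let ?P = "\<lambda>B. bounded_clinear B \<and> (\<forall>x y. cinner (A x) y = cinner x (B y))"
  have "\<exists>!B. ?P B"
  proof (rule ex_ex1I)
    show "\<exists>B. ?P B"
      using assms by (rule adjoint_exists)
    fix B C
    assume "?P B" "?P C"
    then have "cinner (B y) x = cinner (C y) x" for x y
      by (metis cinner_commute)
    then show "B = C"
      by (rule ext[OF cinner_ext])
  qed
  then have "?P (cadjoint A)"
    unfolding cadjoint_def by (rule theI')
  then show "bounded_clinear (cadjoint A)" "cinner (A x) y = cinner x (cadjoint A y)"
    by auto
qed

lemma cinner_cadjoint':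
  fixes A :: "'a :: chilbert_space \<Rightarrow> 'b :: chilbert_space"
  assumes "bounded_clinear A"
  shows "cinner (cadjoint A x) y = cinner x (A y)"
  by (metis cinner_cadjoint[OF assms] cinner_commute)

section \<open>Positive operators and their square roots\<close>

text \<open>Symmetry is polarization: the imaginary part of the form vanishes at \<open>x\<close>,
  \<open>y\<close> and \<open>x + y\<close>, which relates the imaginary parts of the mixed terms,
  and replacing \<open>x\<close> by \<open>\<i> *\<^sub>C x\<close> relates the real parts.\<close>

lemma positive_opD:
  assumes "positive_op A"
  shows "bounded_clinear A" "cinner (A x) y = cinner x (A y)" "A x \<bullet> x \<ge> 0"
proof -
  show A: "bounded_clinear A"
    using assms by (simp add: positive_op_def)
  have Im0: "Im (cinner (A x) x) = 0" and ge0: "Re (cinner (A x) x) \<ge> 0" for x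
    using assms by (simp_all add: positive_op_def complex_nonneg_Reals_iff)
  show "A x \<bullet> x \<ge> 0"
    using ge0[of x] by (simp add: Re_cinner)
  have add: "A (x + y) = A x + A y" for x y
    using A by (simp add: bounded_clinear_def linear_simps)
  have Im: "Im (cinner (A x) y) = - Im (cinner (A y) x)" for x y
    using Im0[of "x + y"] Im0[of x] Im0[of y]
    by (simp add: add cinner_add_left cinner_add_right)
  have Re: "Re (cinner (A x) y) = Re (cinner (A y) x)"
    using Im[of "\<i> *\<^sub>C x" y]
    by (simp add: bounded_clinearD(2)[OF A] cinner_scaleC_left cinner_scaleC_right)
  have "cinner (A x) y = cnj (cinner (A y) x)"
    using Im[of x y] Re by (simp add: complex_eq_iff)
  then show "cinner (A x) y = cinner x (A y)"
    by (metis cinner_commute)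
qed

lemma positive_op_inner_commute:
  "positive_op A \<Longrightarrow> A x \<bullet> y = x \<bullet> A y"
  by (metis positive_opD(2) Re_cinner)

text \<open>Allows positivity to be checked in the real inner product, where the square root is
  constructed.\<close>

lemma positive_opI:
  assumes A: "bounded_clinear A" and sym: "\<And>x y. A x \<bullet> y = x \<bullet> A y"
    and pos: "\<And>x. A x \<bullet> x \<ge> 0"
  shows "positive_op A"
proof -
  have "cinner (A x) x = cnj (cinner (A x) x)" for x
    by (metis cinner_adjoint_from_inner[OF A sym] cinner_commute)
  then have "Im (cinner (A x) x) = 0" for x
    by (metis Reals_cnj_iff complex_is_Real_iff)
  with A pos show ?thesis
    by (simp add: positive_op_def complex_nonneg_Reals_iff Re_cinner)
qed

text \<open>Obtained from \<open>\<langle>A z, z\<rangle> \<ge> 0\<close> at \<open>z = A x - c x\<close>.\<close>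

lemma positive_op_norm_le:
  assumes A: "positive_op A" and c: "\<And>x. norm (A x) \<le> c * norm x" "c > 0"
  shows "(norm (A x))\<^sup>2 \<le> c * (A x \<bullet> x)"
proof -
  interpret bounded_linear A
    using positive_opD(1)[OF A] by (rule bounded_clinearD)
  have "A (A x) \<bullet> A x \<le> norm (A (A x)) * norm (A x)"
    by (rule norm_cauchy_schwarz)
  also have "\<dots> \<le> c * norm (A x) * norm (A x)"
    by (intro mult_right_mono c) simp
  finally have d: "A (A x) \<bullet> A x \<le> c * (A x \<bullet> A x)"
    by (simp add: power2_norm_eq_inner[symmetric] power2_eq_square)
  have "0 \<le> A (A x - c *\<^sub>R x) \<bullet> (A x - c *\<^sub>R x)"
    by (rule positive_opD(3)[OF A])
  also have "\<dots> = A (A x) \<bullet> A x - 2 * c * (A x \<bullet> A x) + c * c * (A x \<bullet> x)"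
    using positive_op_inner_commute[OF A, of "A x" x]
    by (simp add: diff scaleR inner_diff_left inner_diff_right algebra_simps)
  finally have "c * (A x \<bullet> A x) \<le> c * (c * (A x \<bullet> x))"
    using d by (simp add: algebra_simps)
  then show ?thesis
    using c(2) by (simp add: power2_norm_eq_inner)
qed

lemma positive_op_inner_eq_0D:
  assumes A: "positive_op A" and "A x \<bullet> x = 0"
  shows "A x = 0"
proof -
  obtain K where K: "K > 0" "\<And>x. norm (A x) \<le> norm x * K"
    using bounded_linear.pos_bounded[OF bounded_clinearD(1)[OF positive_opD(1)[OF A]]] by blast
  with positive_op_norm_le[OF A, of K x] assms(2) show ?thesis
    by (simp add: mult.commute)
qed

text \<open>
  The iteration solves \<open>2 Y = B + Y\<^sup>2\<close>, that is \<open>(1 - Y)\<^sup>2 = 1 - B\<close>. When \<open>\<parallel>B\<parallel> \<le> 1\<close>, the increments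
  are dominated by those of the scalar iteration with \<open>B = 1\<close>, whose limit is 1.
\<close>

primrec sqrt_iter :: "('a :: real_normed_vector \<Rightarrow>\<^sub>L 'a) \<Rightarrow> nat \<Rightarrow> 'a \<Rightarrow>\<^sub>L 'a" where
  "sqrt_iter B 0 = 0"
| "sqrt_iter B (Suc n) = (1/2) *\<^sub>R (B + (sqrt_iter B n o\<^sub>L sqrt_iter B n))"

primrec sqrt_majorant :: "nat \<Rightarrow> real" where
  "sqrt_majorant 0 = 0"
| "sqrt_majorant (Suc n) = (1 + (sqrt_majorant n)\<^sup>2) / 2"

lemma sqrt_majorant_bounds: "0 \<le> sqrt_majorant n \<and> sqrt_majorant n \<le> 1"
proof (induction n)
  case (Suc n)
  then show ?case
    by (simp add: power_le_one)
qed simp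

lemma sqrt_majorant_mono: "sqrt_majorant n \<le> sqrt_majorant (Suc n)"
proof -
  have "0 \<le> (1 - sqrt_majorant n)\<^sup>2"
    by simp
  then show ?thesis
    by (simp add: power2_eq_square algebra_simps)
qed

text \<open>Serves twice: iterates commute with each other, so that differences of squares factor,
  and the limit inherits commutation with any \<open>C\<close> commuting with
  \<open>B\<close>.\<close>

lemma sqrt_iter_commute:
  assumes "B o\<^sub>L C = C o\<^sub>L B"
  shows "sqrt_iter B n o\<^sub>L C = C o\<^sub>L sqrt_iter B n"
proof (induction n)
  case (Suc n)
  have "sqrt_iter B n (sqrt_iter B n (C x)) = C (sqrt_iter B n (sqrt_iter B n x))"
    "B (C x) = C (B x)" for x
    using Suc assms by (metis blinfun_apply_blinfun_compose)+
  then show ?case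
    by (intro blinfun_eqI) (simp add: blinfun.bilinear_simps)
qed (simp add: blinfun_eqI blinfun.bilinear_simps)

lemma norm_sqrt_iter_le:
  assumes "norm B \<le> 1"
  shows "norm (sqrt_iter B n) \<le> sqrt_majorant n"
proof (induction n)
  case (Suc n)
  have "norm (sqrt_iter B n o\<^sub>L sqrt_iter B n) \<le> (sqrt_majorant n)\<^sup>2"
    by (rule order_trans[OF norm_blinfun_compose])
      (use Suc in \<open>simp add: power2_eq_square mult_mono'\<close>)
  then show ?case
    using norm_triangle_ineq[of B "sqrt_iter B n o\<^sub>L sqrt_iter B n"] assms by simp
qed simp

text \<open>As the iterates commute, the difference of their squares is
  \<open>(Z - Y) o\<^sub>L (Z + Y)\<close>; bounding both factors reproduces the scalar
  factorization of \<open>z\<^sup>2 - y\<^sup>2\<close>.\<close>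

lemma norm_sqrt_iter_diff_le:
  assumes "norm B \<le> 1"
  shows "norm (sqrt_iter B (Suc n) - sqrt_iter B n) \<le> sqrt_majorant (Suc n) - sqrt_majorant n"
proof (induction n)
  case 0
  then show ?case
    using assms by (simp add: blinfun.bilinear_simps)
next
  case (Suc n)
  define Y Z where "Y = sqrt_iter B n" and "Z = sqrt_iter B (Suc n)"
  define y z where "y = sqrt_majorant n" and "z = sqrt_majorant (Suc n)"
  have "Y o\<^sub>L Z = Z o\<^sub>L Y"
    unfolding Y_def Z_def by (intro sqrt_iter_commute sqrt_iter_commute[symmetric]) simp
  then have "Y (Z x) = Z (Y x)" for x
    by (metis blinfun_apply_blinfun_compose)
  then have "(Z o\<^sub>L Z) - (Y o\<^sub>L Y) = (Z - Y) o\<^sub>L (Z + Y)"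
    by (intro blinfun_eqI) (simp add: blinfun.bilinear_simps)
  moreover have "sqrt_iter B (Suc (Suc n)) - Z = (1/2) *\<^sub>R ((Z o\<^sub>L Z) - (Y o\<^sub>L Y))"
    by (simp add: Z_def Y_def algebra_simps)
  ultimately have "norm (sqrt_iter B (Suc (Suc n)) - Z) = norm ((Z - Y) o\<^sub>L (Z + Y)) / 2"
    by simp
  also have "\<dots> \<le> norm (Z - Y) * norm (Z + Y) / 2"
    by (simp add: norm_blinfun_compose)
  also have "\<dots> \<le> (z - y) * (z + y) / 2"
  proof -
    have "norm (Z + Y) \<le> z + y"
      unfolding Z_def Y_def z_def y_def
      by (intro norm_triangle_mono norm_sqrt_iter_le assms)
    then show ?thesis
      using Suc unfolding Z_def[symmetric] Y_def[symmetric] z_def[symmetric] y_def[symmetric]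
      by (intro divide_right_mono mult_mono') auto
  qed
  also have "\<dots> = (1 + z\<^sup>2) / 2 - (1 + y\<^sup>2) / 2"
    by (simp add: power2_eq_square field_simps)
  also have "\<dots> = sqrt_majorant (Suc (Suc n)) - z"
    by (simp add: z_def y_def)
  finally show ?case
    by (simp add: Z_def z_def)
qed

text \<open>The majorant is increasing and bounded, so its increments are summable; they dominate
  those of the iteration, which converges by completeness. The equation is the recursion in the
  limit.\<close>

lemma sqrt_iter_limit:
  fixes B :: "'a :: banach \<Rightarrow>\<^sub>L 'a"
  assumes B: "norm B \<le> 1"
  shows "\<exists>L. sqrt_iter B \<longlonglongrightarrow> L \<and> norm L \<le> 1 \<and> B + (L o\<^sub>L L) = 2 *\<^sub>R L"
proof -
  have "incseq sqrt_majorant"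
    by (intro incseq_SucI sqrt_majorant_mono)
  then obtain l where "sqrt_majorant \<longlonglongrightarrow> l"
    using incseq_convergent[of sqrt_majorant 1] sqrt_majorant_bounds by blast
  then have "summable (\<lambda>n. sqrt_majorant (Suc n) - sqrt_majorant n)"
    by (rule telescope_summable)
  then have "summable (\<lambda>n. sqrt_iter B (Suc n) - sqrt_iter B n)"
    by (rule summable_comparison_test'[of _ 0]) (rule norm_sqrt_iter_diff_le[OF B])
  then have "convergent (\<lambda>n. \<Sum>i<n. sqrt_iter B (Suc i) - sqrt_iter B i)"
    by (simp add: summable_iff_convergent)
  then have "convergent (sqrt_iter B)"
    unfolding sum_lessThan_telescope by simp
  then obtain L where L: "sqrt_iter B \<longlonglongrightarrow> L"
    by (auto simp: convergent_def)
  have "norm L \<le> 1"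
    by (rule LIMSEQ_le_const2[OF tendsto_norm[OF L]])
      (meson norm_sqrt_iter_le[OF B] sqrt_majorant_bounds order_trans)
  moreover have "(\<lambda>n. sqrt_iter B (Suc n)) \<longlonglongrightarrow> (1/2) *\<^sub>R (B + (L o\<^sub>L L))"
    unfolding sqrt_iter.simps
    by (intro tendsto_intros L bounded_bilinear.tendsto[OF bounded_bilinear_blinfun_compose])
  then have "L = (1/2) *\<^sub>R (B + (L o\<^sub>L L))"
    using LIMSEQ_unique LIMSEQ_Suc[OF L] by blast
  then have "B + (L o\<^sub>L L) = 2 *\<^sub>R L"
    by (metis (no_types) scaleR_half_double scaleR_2 scaleR_scaleR scaleR_add_right)
  ultimately show ?thesis
    using L by blast
qed


text \<open>The commutation clause has two uses: with scalar multiplications for \<open>C\<close> it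
  makes \<open>S\<close> complex linear, and with another root for \<open>C\<close> it gives
  uniqueness.\<close>

lemma positive_sqrt_exists:
  fixes A :: "'a :: chilbert_space \<Rightarrow> 'a"
  assumes A: "positive_op A"
  shows "\<exists>S. positive_op S \<and> S \<circ> S = A \<and>
    (\<forall>C. bounded_linear C \<and> C \<circ> A = A \<circ> C \<longrightarrow> C \<circ> S = S \<circ> C)"
proof -
  note linA = bounded_clinearD(1)[OF positive_opD(1)[OF A]]
  obtain c where c: "c > 0" and Ac: "\<And>x. norm (A x) \<le> c * norm x"
    using bounded_linear.pos_bounded[OF linA] by (metis mult.commute)
  \<comment> \<open>Scaling by a bound \<open>c\<close> of \<open>A\<close> makes
    \<open>B = 1 - A/c\<close> a contraction. Its limit \<open>L\<close> satisfies
    \<open>(1 - L)\<^sup>2 = 1 - B = A/c\<close>, so \<open>sqrt c\<close> times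
    \<open>1 - L\<close> squares to \<open>A\<close>.\<close>
  define B where "B = Blinfun (\<lambda>x. x - (1/c) *\<^sub>R A x)"
  have B: "B x = x - (1/c) *\<^sub>R A x" for x
    unfolding B_def
    by (subst bounded_linear_Blinfun_apply)
      (intro bounded_linear_sub bounded_linear_ident
        bounded_linear_compose[OF bounded_linear_scaleR_right] linA, rule refl)
  have "norm B \<le> 1"
  proof (rule norm_blinfun_bound)
    fix x
    have "(norm (A x))\<^sup>2 / c\<^sup>2 \<le> (A x \<bullet> x) / c"
      using positive_op_norm_le[OF A Ac c, of x] c by (simp add: field_simps power2_eq_square)
    moreover have "0 \<le> (A x \<bullet> x) / c"
      using c positive_opD(3)[OF A] by simp
    moreover have "(norm (B x))\<^sup>2 = (norm x)\<^sup>2 - 2 * ((A x \<bullet> x) / c) + (norm (A x))\<^sup>2 / c\<^sup>2"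
      unfolding B power2_norm_eq_inner
      by (simp add: inner_diff_left inner_diff_right inner_commute power2_eq_square[of c])
    ultimately have "(norm (B x))\<^sup>2 \<le> (norm x)\<^sup>2"
      by simp
    then show "norm (B x) \<le> 1 * norm x"
      by simp
  qed simp
  then obtain L where L: "sqrt_iter B \<longlonglongrightarrow> L" "norm L \<le> 1" "B + (L o\<^sub>L L) = 2 *\<^sub>R L"
    using sqrt_iter_limit by blast
  have lim: "(\<lambda>n. sqrt_iter B n x) \<longlonglongrightarrow> L x" for x
    by (intro tendsto_intros L)
  have LL: "L (L x) = 2 *\<^sub>R L x - B x" for x
    using arg_cong[OF L(3), of "\<lambda>F. blinfun_apply F x"]
    by (simp add: blinfun.bilinear_simps algebra_simps)
  have comm: "L (C x) = C (L x)" if "bounded_linear C" "C \<circ> A = A \<circ> C" for C x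
  proof -
    interpret C: bounded_linear C
      by fact
    have CA: "C (A x) = A (C x)" for x
      using that(2) by (metis comp_apply)
    have "B o\<^sub>L Blinfun C = Blinfun C o\<^sub>L B"
      by (rule blinfun_eqI)
        (simp add: bounded_linear_Blinfun_apply[OF that(1)] B C.diff C.scaleR CA)
    then have "sqrt_iter B n (C x) = C (sqrt_iter B n x)" for n
      using sqrt_iter_commute[of B "Blinfun C" n]
      by (metis blinfun_apply_blinfun_compose bounded_linear_Blinfun_apply[OF that(1)])
    then show ?thesis
      using LIMSEQ_unique[OF lim[of "C x"]] C.tendsto[OF lim[of x]] by simp
  qed
  have symY: "sqrt_iter B n x \<bullet> y = x \<bullet> sqrt_iter B n y" for n x y
  proof (induction n arbitrary: x y)
    case (Suc n)
    have "B x \<bullet> y = x \<bullet> B y"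
      using positive_op_inner_commute[OF A, of x y]
      by (simp add: B inner_diff_left inner_diff_right)
    with Suc show ?case
      by (simp add: blinfun.bilinear_simps inner_add_left inner_add_right)
  qed simp
  have symL: "L x \<bullet> y = x \<bullet> L y" for x y
    using LIMSEQ_unique[OF tendsto_inner[OF lim[of x] tendsto_const, of y]]
      tendsto_inner[OF tendsto_const lim[of y], of x]
    by (simp add: symY)
  define S where "S = (\<lambda>x. sqrt c *\<^sub>R (x - L x))"
  have linS: "bounded_linear S"
    unfolding S_def
    by (intro bounded_linear_compose[OF bounded_linear_scaleR_right] bounded_linear_sub
        bounded_linear_ident blinfun.bounded_linear_right)
  have commS: "C \<circ> S = S \<circ> C" if "bounded_linear C" "C \<circ> A = A \<circ> C" for C
  proof -
    interpret C: bounded_linear C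
      by fact
    show ?thesis
      by (rule ext) (simp add: S_def C.scaleR C.diff comm[OF that])
  qed
  have "S (S x) = A x" for x
  proof -
    have "S (S x) = c *\<^sub>R (x - B x)"
      using c by (simp add: S_def LL blinfun.bilinear_simps algebra_simps scaleR_2)
    then show ?thesis
      using c by (simp add: B)
  qed
  then have "S \<circ> S = A"
    by auto
  moreover have "positive_op S"
  proof (rule positive_opI)
    have "(\<lambda>x. k *\<^sub>C x) \<circ> S = S \<circ> (\<lambda>x. k *\<^sub>C x)" for k
      by (rule commS[OF bounded_linear_scaleC])
        (simp add: fun_eq_iff bounded_clinearD(2)[OF positive_opD(1)[OF A]])
    then show "bounded_clinear S"
      using linS unfolding bounded_clinear_def by (metis comp_apply)
    show "S x \<bullet> y = x \<bullet> S y" for x y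
      by (simp add: S_def inner_diff_left inner_diff_right symL)
    \<comment> \<open>Positivity of \<open>1 - L\<close> is where the bound
      \<open>norm L \<le> 1\<close> enters.\<close>
    show "0 \<le> S x \<bullet> x" for x
    proof -
      have "L x \<bullet> x \<le> norm (L x) * norm x"
        by (rule norm_cauchy_schwarz)
      also have "\<dots> \<le> (1 * norm x) * norm x"
        by (intro mult_right_mono order_trans[OF norm_blinfun] L(2)) simp_all
      finally show ?thesis
        using c by (simp add: S_def inner_diff_left power2_norm_eq_inner[symmetric] power2_eq_square)
    qed
  qed
  ultimately show ?thesis
    using commS by blast
qed

text \<open>For \<open>y = (R - S) x\<close>, commutation gives
  \<open>(R + S) y = (R\<^sup>2 - S\<^sup>2) x = 0\<close>. Both forms then vanish at
  \<open>y\<close>, so \<open>R y = S y = 0\<close>, and by symmetry \<open>y\<close> is orthogonal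
  to \<open>R x\<close> and \<open>S x\<close>, hence to itself.\<close>

lemma positive_sqrt_unique:
  assumes R: "positive_op R" and S: "positive_op S" and RS: "R \<circ> R = S \<circ> S"
    and comm: "R \<circ> S = S \<circ> R"
  shows "R = S"
proof (rule ext)
  fix x
  interpret R: bounded_linear R
    by (rule bounded_clinearD[OF positive_opD(1)[OF R]])
  interpret S: bounded_linear S
    by (rule bounded_clinearD[OF positive_opD(1)[OF S]])
  define y where "y = R x - S x"
  have "R (R x) = S (S x)" "R (S x) = S (R x)"
    using RS comm by (metis comp_apply)+
  then have "R y + S y = 0"
    by (simp add: y_def R.diff S.diff)
  then have "R y \<bullet> y + S y \<bullet> y = 0"
    by (metis inner_add_left inner_zero_left)
  then have "R y \<bullet> y = 0" "S y \<bullet> y = 0"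
    using positive_opD(3)[OF R, of y] positive_opD(3)[OF S, of y] by linarith+
  then have "R y = 0" "S y = 0"
    using R S by (auto intro: positive_op_inner_eq_0D)
  then have "y \<bullet> R x = 0" "y \<bullet> S x = 0"
    using positive_op_inner_commute[OF R, of y x] positive_op_inner_commute[OF S, of y x] by simp_all
  then have "y \<bullet> y = 0"
    by (simp add: y_def inner_diff_right)
  then show "R x = S x"
    by (simp add: y_def)
qed

lemma
  fixes A :: "'a :: chilbert_space \<Rightarrow> 'a"
  assumes A: "positive_op A"
  shows positive_op_sqrt_op: "positive_op (sqrt_op A)"
    and sqrt_op_sqrt_op: "sqrt_op A (sqrt_op A x) = A x"
proof -
  obtain S where S: "positive_op S" "S \<circ> S = A"
    and comm: "\<And>C. bounded_linear C \<Longrightarrow> C \<circ> A = A \<circ> C \<Longrightarrow> C \<circ> S = S \<circ> C"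
    using positive_sqrt_exists[OF A] by blast
  \<comment> \<open>Any root \<open>R\<close> commutes with its own square \<open>A\<close>, hence
    with \<open>S\<close> by the commutation clause.\<close>
  have "R = S" if R: "positive_op R" "R \<circ> R = A" for R
  proof (rule positive_sqrt_unique[OF R(1) S(1)])
    show "R \<circ> R = S \<circ> S"
      using R(2) S(2) by simp
    show "R \<circ> S = S \<circ> R"
      by (rule comm[OF bounded_clinearD(1)[OF positive_opD(1)[OF R(1)]]])
        (simp add: R(2)[symmetric] o_assoc)
  qed
  then have "sqrt_op A = S"
    unfolding sqrt_op_def using S by blast
  with S show "positive_op (sqrt_op A)" "sqrt_op A (sqrt_op A x) = A x"
    by auto
qed

text \<open>Both inner products equal that of \<open>cadjoint A (A x)\<close> with \<open>y\<close>.
  The equality of norms is what makes sending \<open>abs_op A x\<close> to \<open>A x\<close> a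
  well-defined isometry.\<close>

lemma
  fixes A :: "'a :: chilbert_space \<Rightarrow> 'a"
  assumes A: "bounded_clinear A"
  shows positive_op_abs_op: "positive_op (abs_op A)"
    and cinner_abs_op: "cinner (abs_op A x) (abs_op A y) = cinner (A x) (A y)"
    and norm_abs_op: "norm (abs_op A x) = norm (A x)"
proof -
  have "cinner ((cadjoint A \<circ> A) x) x = complex_of_real ((norm (A x))\<^sup>2)" for x
    by (simp add: cinner_cadjoint'[OF A] cinner_self)
  then have pos: "positive_op (cadjoint A \<circ> A)"
    unfolding positive_op_def
    using bounded_clinear_compose[OF bounded_clinear_cadjoint[OF A] A]
    by (simp del: of_real_power comp_apply)
  show P: "positive_op (abs_op A)"
    unfolding abs_op_def by (rule positive_op_sqrt_op[OF pos])
  have *: "abs_op A (abs_op A x) = cadjoint A (A x)" for x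
    unfolding abs_op_def sqrt_op_sqrt_op[OF pos] by simp
  show **: "cinner (abs_op A x) (abs_op A y) = cinner (A x) (A y)" for x y
    using positive_opD(2)[OF P, of "abs_op A x" y]
    by (simp add: * cinner_cadjoint'[OF A])
  have "complex_of_real ((norm (abs_op A x))\<^sup>2) = complex_of_real ((norm (A x))\<^sup>2)"
    unfolding cinner_self[symmetric] by (rule **)
  then show "norm (abs_op A x) = norm (A x)"
    by (simp add: power2_eq_iff_nonneg del: of_real_power)
qed

section \<open>Polar decomposition and the Aluthge transform\<close>

text \<open>
  \<open>polar_rel A x b\<close> says that \<open>x = a + a'\<close>, where \<open>(a, b)\<close> lies in the closure of the set of pairs
  \<open>(\<bar>A\<bar> u, A u)\<close> and \<open>a'\<close> is orthogonal to the range of \<open>\<bar>A\<bar>\<close>. It is the graph of the partial isometry.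
\<close>

definition polar_rel :: "('a :: chilbert_space \<Rightarrow> 'a) \<Rightarrow> 'a \<Rightarrow> 'a \<Rightarrow> bool"
  where "polar_rel A x b \<longleftrightarrow> (\<exists>u a. (\<lambda>n :: nat. abs_op A (u n)) \<longlonglongrightarrow> a \<and> (\<lambda>n. A (u n)) \<longlonglongrightarrow> b \<and>
    (\<forall>w. cinner (x - a) (abs_op A w) = 0))"

text \<open>The gain over the definition is the last fact: orthogonality to the range passes to the
  limit \<open>a\<close>.\<close>

lemma polar_relE:
  assumes "polar_rel A x b"
  obtains u a where "(\<lambda>n :: nat. abs_op A (u n)) \<longlonglongrightarrow> a" "(\<lambda>n. A (u n)) \<longlonglongrightarrow> b"
    and "\<forall>w. cinner (x - a) (abs_op A w) = 0" "cinner (x - a) a = 0"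
proof -
  from assms obtain u a where *: "(\<lambda>n :: nat. abs_op A (u n)) \<longlonglongrightarrow> a" "(\<lambda>n. A (u n)) \<longlonglongrightarrow> b"
    "\<forall>w. cinner (x - a) (abs_op A w) = 0"
    unfolding polar_rel_def by blast
  have "(\<lambda>n. cinner (x - a) (abs_op A (u n))) \<longlonglongrightarrow> cinner (x - a) a"
    by (intro tendsto_cinner tendsto_const *)
  then have "cinner (x - a) a = 0"
    by (simp add: *(3)[rule_format] LIMSEQ_const_iff)
  with * show thesis
    by (rule that)
qed

lemma polar_rel_add:
  assumes A: "bounded_clinear A" and "polar_rel A x b" "polar_rel A y c"
  shows "polar_rel A (x + y) (b + c)"
proof -
  obtain u a where u: "(\<lambda>n :: nat. abs_op A (u n)) \<longlonglongrightarrow> a" "(\<lambda>n. A (u n)) \<longlonglongrightarrow> b"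
    "\<forall>w. cinner (x - a) (abs_op A w) = 0" "cinner (x - a) a = 0"
    using assms(2) by (rule polar_relE)
  obtain v a' where v: "(\<lambda>n :: nat. abs_op A (v n)) \<longlonglongrightarrow> a'" "(\<lambda>n. A (v n)) \<longlonglongrightarrow> c"
    "\<forall>w. cinner (y - a') (abs_op A w) = 0" "cinner (y - a') a' = 0"
    using assms(3) by (rule polar_relE)
  note lin = bounded_clinearD(1)[OF A]
    bounded_clinearD(1)[OF positive_opD(1)[OF positive_op_abs_op[OF A]]]
  have "(\<lambda>n. abs_op A (u n + v n)) \<longlonglongrightarrow> a + a'" "(\<lambda>n. A (u n + v n)) \<longlonglongrightarrow> b + c"
    using tendsto_add[OF u(1) v(1)] tendsto_add[OF u(2) v(2)] lin by (simp_all add: linear_simps)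
  moreover have "cinner (x + y - (a + a')) (abs_op A w) = 0" for w
    using u(3) v(3) cinner_add_left[of "x - a" "y - a'" "abs_op A w"] by (simp add: algebra_simps)
  ultimately show ?thesis
    unfolding polar_rel_def by (intro exI[of _ "\<lambda>n. u n + v n"] exI[of _ "a + a'"]) blast
qed

lemma polar_rel_scaleC:
  assumes A: "bounded_clinear A" and "polar_rel A x b"
  shows "polar_rel A (k *\<^sub>C x) (k *\<^sub>C b)"
proof -
  obtain u a where u: "(\<lambda>n :: nat. abs_op A (u n)) \<longlonglongrightarrow> a" "(\<lambda>n. A (u n)) \<longlonglongrightarrow> b"
    "\<forall>w. cinner (x - a) (abs_op A w) = 0" "cinner (x - a) a = 0"
    using assms(2) by (rule polar_relE)
  have "(\<lambda>n. abs_op A (k *\<^sub>C u n)) \<longlonglongrightarrow> k *\<^sub>C a" "(\<lambda>n. A (k *\<^sub>C u n)) \<longlonglongrightarrow> k *\<^sub>C b"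
    using bounded_linear.tendsto[OF bounded_linear_scaleC u(1)]
      bounded_linear.tendsto[OF bounded_linear_scaleC u(2)]
    by (simp_all add: bounded_clinearD(2)[OF A]
        bounded_clinearD(2)[OF positive_opD(1)[OF positive_op_abs_op[OF A]]])
  moreover have "cinner (k *\<^sub>C x - k *\<^sub>C a) (abs_op A w) = 0" for w
    using u(3) by (simp add: cinner_diff_left cinner_scaleC_left)
  ultimately show ?thesis
    unfolding polar_rel_def by (intro exI[of _ "\<lambda>n. k *\<^sub>C u n"] exI[of _ "k *\<^sub>C a"]) blast
qed

text \<open>\<open>b\<close> has the norm of \<open>a\<close>, and \<open>a\<close> is an orthogonal
  projection of \<open>x\<close>. This yields both single-valuedness and boundedness of the map
  defined by the relation.\<close>

lemma polar_rel_norm_le: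
  assumes A: "bounded_clinear A" and "polar_rel A x b"
  shows "norm b \<le> norm x"
proof -
  obtain u a where u: "(\<lambda>n :: nat. abs_op A (u n)) \<longlonglongrightarrow> a" "(\<lambda>n. A (u n)) \<longlonglongrightarrow> b"
    "\<forall>w. cinner (x - a) (abs_op A w) = 0" "cinner (x - a) a = 0"
    using assms(2) by (rule polar_relE)
  have "norm b = norm a"
    using LIMSEQ_unique[OF tendsto_norm[OF u(2)]] tendsto_norm[OF u(1)]
    by (simp add: norm_abs_op[OF A])
  moreover have "(x - a) \<bullet> a = 0"
    by (metis Re_cinner u(4) zero_complex.simps(1))
  then have "(norm a)\<^sup>2 = x \<bullet> a"
    by (simp add: inner_diff_left power2_norm_eq_inner)
  then have "norm a * norm a \<le> norm x * norm a"
    by (metis norm_cauchy_schwarz power2_eq_square)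
  then have "norm a \<le> norm x"
    by (cases "a = 0") simp_all
  ultimately show ?thesis
    by simp
qed

text \<open>By linearity 0 is related to \<open>b - c\<close>, and the norm bound then makes it
  vanish.\<close>

lemma polar_rel_unique:
  assumes A: "bounded_clinear A" and "polar_rel A x b" "polar_rel A x c"
  shows "b = c"
proof -
  have "polar_rel A (x + (- 1) *\<^sub>C x) (b + (- 1) *\<^sub>C c)"
    by (intro polar_rel_add polar_rel_scaleC assms)
  moreover have "(- 1) *\<^sub>C y = - y" for y :: 'a
    using scaleC_of_real[of "- 1" y] by simp
  ultimately show ?thesis
    using polar_rel_norm_le[OF A] by fastforce
qed

text \<open>Take \<open>a\<close> to be the projection of \<open>x\<close> onto the closed range of
  \<open>abs_op A\<close>. Along a sequence approximating \<open>a\<close>, the vectors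
  \<open>A (u n)\<close> have the same mutual distances as \<open>abs_op A (u n)\<close>, so they
  converge too.\<close>

lemma polar_rel_total:
  assumes A: "bounded_clinear A"
  shows "\<exists>b. polar_rel A x b"
proof -
  interpret A: bounded_linear A
    by (rule bounded_clinearD[OF A])
  let ?P = "abs_op A"
  have P: "bounded_clinear ?P"
    by (rule positive_opD(1)[OF positive_op_abs_op[OF A]])
  interpret P: bounded_linear ?P
    by (rule bounded_clinearD[OF P])
  have "subspace (closure (range ?P))"
    by (intro subspace_closure linear_subspace_image P.linear_axioms subspace_UNIV)
  from orthogonal_projection_exists[OF this closed_closure, of x]
  obtain a where a: "a \<in> closure (range ?P)"
    and "\<forall>s\<in>closure (range ?P). (x - a) \<bullet> s = 0"
    by (rule bexE)
  then have orth: "(x - a) \<bullet> s = 0" if "s \<in> closure (range ?P)" for s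
    using that by simp
  have Re0: "Re (cinner (x - a) (?P w)) = 0" for w
    unfolding Re_cinner by (rule orth[OF closure_subset[THEN subsetD, OF rangeI]])
  have perp: "cinner (x - a) (?P w) = 0" for w
  proof (rule complex_eqI)
    show "Im (cinner (x - a) (?P w)) = Im 0"
      using Re0[of "\<i> *\<^sub>C w"] unfolding cinner_Im by (simp add: bounded_clinearD(2)[OF P])
  qed (simp add: Re0)
  obtain p where p: "\<And>n. p n \<in> range ?P" "p \<longlonglongrightarrow> a"
    using a unfolding closure_sequential by blast
  then have "\<forall>n. \<exists>u. p n = ?P u"
    by blast
  then obtain u where u: "\<And>n. p n = ?P (u n)"
    by metis
  then have Pu: "(\<lambda>n. ?P (u n)) \<longlonglongrightarrow> a"
    using p(2) by (simp flip: u)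
  have "dist (A (u m)) (A (u n)) = dist (?P (u m)) (?P (u n))" for m n
    by (simp add: dist_norm norm_abs_op[OF A] flip: A.diff P.diff)
  then have "Cauchy (\<lambda>n. A (u n))"
    using LIMSEQ_imp_Cauchy[OF Pu] unfolding Cauchy_def by simp
  then obtain b where "(\<lambda>n. A (u n)) \<longlonglongrightarrow> b"
    by (auto simp: Cauchy_convergent_iff convergent_def)
  with Pu perp show ?thesis
    unfolding polar_rel_def by blast
qed

lemma polar_decomposition_exists:
  fixes A :: "'a :: chilbert_space \<Rightarrow> 'a"
  assumes A: "bounded_clinear A"
  shows "\<exists>V. polar_decomposition A V"
proof -
  let ?P = "abs_op A"
  interpret P: bounded_linear ?P
    by (rule bounded_clinearD[OF positive_opD(1)[OF positive_op_abs_op[OF A]]])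
  interpret A: bounded_linear A
    by (rule bounded_clinearD[OF A])
  obtain V where V: "\<And>x. polar_rel A x (V x)"
    using polar_rel_total[OF A] by metis
  have V_eq: "V x = b" if "polar_rel A x b" for x b
    using polar_rel_unique[OF A V that] .
  have scaleC: "V (c *\<^sub>C x) = c *\<^sub>C V x" for c x
    by (intro V_eq polar_rel_scaleC[OF A] V)
  have "bounded_linear V"
  proof (rule bounded_linear_intro)
    show "V (x + y) = V x + V y" for x y
      by (intro V_eq polar_rel_add[OF A] V)
    show "V (r *\<^sub>R x) = r *\<^sub>R V x" for r x
      by (metis scaleC scaleC_of_real)
    show "norm (V x) \<le> norm x * 1" for x
      using polar_rel_norm_le[OF A V] by simp
  qed
  with scaleC have clinV: "bounded_clinear V"
    by (simp add: bounded_clinear_def)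
  have VP: "V (?P x) = A x" for x
    by (rule V_eq) (auto simp: polar_rel_def cinner_zero_left intro!: exI[of _ "\<lambda>n. x"])
  \<comment> \<open>The remainder \<open>x - a\<close> is related to 0, so it lies in the kernel of
    \<open>V\<close>; an \<open>x\<close> orthogonal to the kernel therefore equals its projection
    \<open>a\<close>.\<close>
  have "norm (V x) = norm x" if x: "\<And>k. V k = 0 \<Longrightarrow> cinner x k = 0" for x
  proof -
    obtain u a where u: "(\<lambda>n :: nat. ?P (u n)) \<longlonglongrightarrow> a" "(\<lambda>n. A (u n)) \<longlonglongrightarrow> V x"
      "\<forall>w. cinner (x - a) (?P w) = 0" "cinner (x - a) a = 0"
      using V by (rule polar_relE)
    have "polar_rel A (x - a) 0"
      unfolding polar_rel_def
      by (intro exI[of _ "\<lambda>n. 0"] exI[of _ 0]) (simp add: P.zero A.zero u(3))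
    then have "cinner x (x - a) = 0"
      by (intro x V_eq)
    moreover have "cinner a (x - a) = 0"
      by (metis cinner_commute complex_cnj_zero u(4))
    ultimately have "cinner (x - a) (x - a) = 0"
      by (simp add: cinner_diff_left)
    then have "x = a"
      by (simp add: cinner_self)
    then show ?thesis
      using LIMSEQ_unique[OF tendsto_norm[OF u(2)]] tendsto_norm[OF u(1)]
      by (simp add: norm_abs_op[OF A])
  qed
  then have "partial_isometry V"
    using clinV by (simp add: partial_isometry_def)
  moreover have "A = V \<circ> ?P"
    by (simp add: fun_eq_iff VP)
  \<comment> \<open>Tested against \<open>y\<close>: the inner product of \<open>A x\<close> with
    \<open>V y\<close> is the limit of those with \<open>A (u n)\<close>, which equal those of
    \<open>?P x\<close> with \<open>?P (u n)\<close>; and \<open>y - a\<close> is orthogonal to the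
    range of \<open>?P\<close>.\<close>
  moreover have "cadjoint V (V (?P x)) = ?P x" for x
  proof (rule cinner_ext)
    fix y
    obtain u a where u: "(\<lambda>n :: nat. ?P (u n)) \<longlonglongrightarrow> a" "(\<lambda>n. A (u n)) \<longlonglongrightarrow> V y"
      "\<forall>w. cinner (y - a) (?P w) = 0" "cinner (y - a) a = 0"
      using V by (rule polar_relE)
    have "(\<lambda>n. cinner (A x) (A (u n))) \<longlonglongrightarrow> cinner (A x) (V y)"
      by (intro tendsto_cinner tendsto_const u)
    moreover have "(\<lambda>n. cinner (?P x) (?P (u n))) \<longlonglongrightarrow> cinner (?P x) a"
      by (intro tendsto_cinner tendsto_const u)
    ultimately have "cinner (A x) (V y) = cinner (?P x) a"
      by (simp add: cinner_abs_op[OF A] LIMSEQ_unique)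
    moreover have "cinner (?P x) (y - a) = 0"
      by (metis cinner_commute complex_cnj_zero u(3))
    ultimately show "cinner (cadjoint V (V (?P x))) y = cinner (?P x) y"
      by (simp add: cinner_cadjoint'[OF clinV] VP cinner_diff_right)
  qed
  ultimately show ?thesis
    unfolding polar_decomposition_def by (auto simp: fun_eq_iff)
qed

text \<open>Removing the projection \<open>a\<close> of \<open>x\<close> onto the kernel leaves
  \<open>V x\<close> unchanged, \<open>V\<close> is isometric on \<open>x - a\<close>, and
  Pythagoras bounds the norm of \<open>x - a\<close>.\<close>

lemma partial_isometry_norm_le:
  assumes "partial_isometry V"
  shows "norm (V x) \<le> norm x"
proof -
  have clin: "bounded_clinear V"
    and iso: "\<And>x. (\<And>k. V k = 0 \<Longrightarrow> cinner x k = 0) \<Longrightarrow> norm (V x) = norm x"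
    using assms by (auto simp: partial_isometry_def)
  interpret V: bounded_linear V
    by (rule bounded_clinearD[OF clin])
  define S where "S = {x. V x = 0}"
  have "subspace S"
    by (auto simp: S_def subspace_def V.add V.scaleR V.zero)
  moreover have "closed S"
    unfolding S_def by (intro closed_Collect_eq continuous_intros V.continuous_on)
  ultimately obtain a where a: "V a = 0" "\<And>s. V s = 0 \<Longrightarrow> (x - a) \<bullet> s = 0"
    using orthogonal_projection_exists[of S x] by (auto simp: S_def)
  have "cinner (x - a) k = 0" if k: "V k = 0" for k
  proof (rule complex_eqI)
    show "Re (cinner (x - a) k) = Re 0"
      using a(2)[OF k] by (simp add: Re_cinner)
    have "V (\<i> *\<^sub>C k) = 0"
      using k linear_0[OF bounded_linear.linear[OF bounded_linear_scaleC]]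
      by (simp add: bounded_clinearD(2)[OF clin])
    then show "Im (cinner (x - a) k) = Im 0"
      unfolding cinner_Im using a(2) by (simp add: Re_cinner)
  qed
  then have "norm (V (x - a)) = norm (x - a)"
    by (rule iso)
  then have "norm (V x) = norm (x - a)"
    by (simp add: V.diff a(1))
  moreover have "(norm (x - a))\<^sup>2 + (norm a)\<^sup>2 = (norm x)\<^sup>2"
    using a(2)[OF a(1)] norm_add_Pythagorean[of "x - a" a] by (simp add: orthogonal_def)
  then have "(norm (x - a))\<^sup>2 \<le> (norm x)\<^sup>2"
    by (metis le_add_same_cancel1 zero_le_power2)
  ultimately show ?thesis
    by simp
qed

text \<open>If \<open>W \<bar>A\<bar> = 0\<close>, then \<open>(W \<bar>A\<bar>\<^sup>1\<^sup>/\<^sup>2) (W \<bar>A\<bar>\<^sup>1\<^sup>/\<^sup>2)\<^sup>* = 0\<close>.\<close>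

lemma polar_decomposition_sqrt_unique:
  fixes A :: "'a :: chilbert_space \<Rightarrow> 'a"
  assumes A: "bounded_clinear A" and V: "polar_decomposition A V" and W: "polar_decomposition A W"
  shows "V (sqrt_op (abs_op A) x) = W (sqrt_op (abs_op A) x)"
proof -
  let ?P = "sqrt_op (abs_op A)"
  have P: "positive_op ?P"
    and PP: "\<And>x. ?P (?P x) = abs_op A x"
    by (simp_all add: positive_op_sqrt_op sqrt_op_sqrt_op positive_op_abs_op[OF A])
  have clin: "bounded_clinear V" "bounded_clinear W"
    using V W by (simp_all add: polar_decomposition_def partial_isometry_def)
  have "A x = V (abs_op A x)" "A x = W (abs_op A x)" for x
    using V W unfolding polar_decomposition_def by (auto simp: fun_eq_iff)
  then have VW: "V (?P (?P x)) = W (?P (?P x))" for x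
    by (metis PP)
  have adj: "cinner (V (?P x) - W (?P x)) y = cinner x (?P (cadjoint V y - cadjoint W y))" for x y
    unfolding positive_opD(2)[OF P, symmetric]
    by (simp add: cinner_diff_left cinner_diff_right cinner_cadjoint[OF clin(1)]
        cinner_cadjoint[OF clin(2)])
  have "?P (cadjoint V y - cadjoint W y) = 0" for y
  proof -
    define z where "z = ?P (cadjoint V y - cadjoint W y)"
    have "cinner z z = 0"
      using adj[of z y] VW[of "cadjoint V y - cadjoint W y"]
      by (simp add: z_def cinner_zero_left)
    then show ?thesis
      by (simp add: cinner_self z_def)
  qed
  then have "cinner (V (?P x)) y = cinner (W (?P x)) y" for y
    using adj[of x y] by (simp add: cinner_zero_right cinner_diff_left)
  then show ?thesis
    by (rule cinner_ext)
qed

lemma aluthge_eq: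
  fixes A :: "'a :: chilbert_space \<Rightarrow> 'a"
  assumes A: "bounded_clinear A" and V: "polar_decomposition A V"
  shows "aluthge A = sqrt_op (abs_op A) \<circ> V \<circ> sqrt_op (abs_op A)"
  unfolding aluthge_def
proof (rule the_equality)
  fix B
  assume "\<exists>W. polar_decomposition A W \<and> B = sqrt_op (abs_op A) \<circ> W \<circ> sqrt_op (abs_op A)"
  then show "B = sqrt_op (abs_op A) \<circ> V \<circ> sqrt_op (abs_op A)"
    using polar_decomposition_sqrt_unique[OF A V] by (auto simp: fun_eq_iff)
qed (use V in blast)

section \<open>Numerical radius\<close>

lemma numerical_radius_bdd_above:
  assumes "bounded_linear A"
  shows "bdd_above {cmod (cinner (A z) z) | z. norm z = 1}"
proof -
  have "cmod (cinner (A z) z) \<le> onorm A" if "norm z = 1" for z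
    using cmod_cinner_le[of "A z" z] onorm[OF assms, of z] that by simp
  then show ?thesis
    by (intro bdd_aboveI[of _ "onorm A"]) auto
qed

lemma numerical_radius_nonneg:
  "bounded_linear A \<Longrightarrow> numerical_radius A \<ge> 0"
  unfolding numerical_radius_def by (rule cSup_upper) (simp_all add: numerical_radius_bdd_above)

lemma numerical_radius_bound:
  fixes A :: "'a :: chilbert_space \<Rightarrow> 'a"
  assumes A: "bounded_linear A"
  shows "cmod (cinner (A z) z) \<le> numerical_radius A * (norm z)\<^sup>2"
proof (cases "z = 0")
  case False
  interpret bounded_linear A
    by fact
  let ?z = "(1 / norm z) *\<^sub>R z"
  have "cmod (cinner (A ?z) ?z) \<le> numerical_radius A"
    unfolding numerical_radius_def
    by (rule cSup_upper) (use False in \<open>auto simp: numerical_radius_bdd_above[OF A]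
        intro!: exI[of _ ?z]\<close>)
  moreover have "cinner (A ?z) ?z = (1 / (norm z)\<^sup>2) *\<^sub>R cinner (A z) z"
    by (simp add: scaleR cinner_scaleR_left cinner_scaleR_right power2_eq_square)
  ultimately have "cmod (cinner (A z) z) / (norm z)\<^sup>2 \<le> numerical_radius A"
    by simp
  then show ?thesis
    using False by (simp add: divide_le_eq)
qed (simp add: cinner_zero_right)

text \<open>\<open>M \<ge> 0\<close> accounts for the inserted 0, the only element of the set on the
  zero space.\<close>

lemma numerical_radius_le:
  assumes "M \<ge> 0" "\<And>z. norm z = 1 \<Longrightarrow> cmod (cinner (A z) z) \<le> M"
  shows "numerical_radius A \<le> M"
  unfolding numerical_radius_def by (rule cSup_least) (use assms in auto)

text \<open>
  This is Yamazaki's inequality. With \<open>P = \<bar>A\<bar>\<^sup>1\<^sup>/\<^sup>2\<close> and \<open>u\<close> on the unit circle, polarization gives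
  \<open>4 Re (u \<langle>A z, z\<rangle>) \<le> \<parallel>P (u + V\<^sup>*) z\<parallel>\<^sup>2\<close>, and \<open>(P (u + V\<^sup>*)) (P (u + V\<^sup>*))\<^sup>* \<le> 2 \<bar>A\<bar> + 2 Re (u P V P)\<close>
  because \<open>V\<close> is a contraction.
\<close>

theorem numerical_radius_le_aluthge:
  fixes A :: "'a :: chilbert_space \<Rightarrow> 'a"
  assumes A: "bounded_clinear A"
  shows "numerical_radius A \<le> (onorm A + numerical_radius (aluthge A)) / 2"
proof -
  obtain V where V: "polar_decomposition A V"
    using polar_decomposition_exists[OF A] by blast
  define P where "P = sqrt_op (abs_op A)"
  have P: "positive_op P" and PP: "\<And>x. P (P x) = abs_op A x"
    by (simp_all add: P_def positive_op_sqrt_op sqrt_op_sqrt_op positive_op_abs_op[OF A])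
  have iso: "partial_isometry V" and AV: "\<And>x. A x = V (P (P x))"
    using V unfolding polar_decomposition_def PP by (auto simp: fun_eq_iff)
  then have clinV: "bounded_clinear V"
    by (simp add: partial_isometry_def)
  interpret P: bounded_linear P
    by (rule bounded_clinearD[OF positive_opD(1)[OF P]])
  note linA = bounded_clinearD(1)[OF A]
  define T where "T = aluthge A"
  have T: "T x = P (V (P x))" for x
    by (simp add: T_def aluthge_eq[OF A V] P_def)
  have linT: "bounded_linear T"
    unfolding T
    by (rule bounded_linear_compose[OF P.bounded_linear_axioms
          bounded_linear_compose[OF bounded_clinearD(1)[OF clinV] P.bounded_linear_axioms]])
  define M where "M = onorm A + numerical_radius T"
  have M: "M \<ge> 0"
    using onorm_pos_le[OF linA] numerical_radius_nonneg[OF linT] by (simp add: M_def)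
  have adjoint_bound: "(norm (cnj u *\<^sub>C P y + V (P y)))\<^sup>2 \<le> 2 * M * (norm y)\<^sup>2"
    if u: "cmod u = 1" for u y
  proof -
    have Py: "(norm (P y))\<^sup>2 \<le> onorm A * (norm y)\<^sup>2"
    proof -
      have "(norm (P y))\<^sup>2 = abs_op A y \<bullet> y"
        by (simp add: power2_norm_eq_inner positive_op_inner_commute[OF P, symmetric] PP)
      also have "\<dots> \<le> norm (A y) * norm y"
        using norm_cauchy_schwarz[of "abs_op A y" y] by (simp add: norm_abs_op[OF A])
      also have "\<dots> \<le> (onorm A * norm y) * norm y"
        by (intro mult_right_mono onorm[OF linA]) simp
      finally show ?thesis
        by (simp add: power2_eq_square mult.assoc)
    qed
    have "(cnj u *\<^sub>C P y) \<bullet> V (P y) = Re (cnj u * cnj (cinner (T y) y))"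
      by (metis Re_cinner T cinner_commute cinner_scaleC_left positive_opD(2)[OF P])
    also have "\<dots> \<le> cmod (cnj u * cnj (cinner (T y) y))"
      by (rule complex_Re_le_cmod)
    also have "\<dots> \<le> numerical_radius T * (norm y)\<^sup>2"
      using numerical_radius_bound[OF linT, of y] by (simp add: norm_mult u)
    finally have cross: "(cnj u *\<^sub>C P y) \<bullet> V (P y) \<le> numerical_radius T * (norm y)\<^sup>2" .
    have "(norm (V (P y)))\<^sup>2 \<le> (norm (P y))\<^sup>2"
      by (intro power_mono partial_isometry_norm_le[OF iso]) simp
    moreover have "(norm (cnj u *\<^sub>C P y + V (P y)))\<^sup>2 =
        (norm (P y))\<^sup>2 + (norm (V (P y)))\<^sup>2 + 2 * ((cnj u *\<^sub>C P y) \<bullet> V (P y))"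
      using dot_norm[of "cnj u *\<^sub>C P y" "V (P y)"] by (simp add: norm_scaleC u)
    moreover have "2 * M * (norm y)\<^sup>2 =
        2 * (onorm A * (norm y)\<^sup>2) + 2 * (numerical_radius T * (norm y)\<^sup>2)"
      by (simp add: M_def algebra_simps)
    ultimately show ?thesis
      using cross Py by linarith
  qed
  have bound: "(norm (u *\<^sub>C P z + P (cadjoint V z)))\<^sup>2 \<le> 2 * M"
    if u: "cmod u = 1" and z: "norm z = 1" for u z
  proof -
    define y where "y = u *\<^sub>C P z + P (cadjoint V z)"
    have "cinner y y = cinner (cnj u *\<^sub>C P y + V (P y)) z"
    proof -
      have "cinner y y = cinner y (u *\<^sub>C P z) + cinner y (P (cadjoint V z))"
        by (subst (2) y_def) (rule cinner_add_right)
      then show ?thesis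
        by (simp add: cinner_add_left cinner_scaleC_left cinner_scaleC_right
            cinner_cadjoint[OF clinV] positive_opD(2)[OF P])
    qed
    then have "(norm y)\<^sup>2 = cmod (cinner (cnj u *\<^sub>C P y + V (P y)) z)"
      by (metis cinner_self norm_of_real abs_of_nonneg zero_le_power2)
    also have "\<dots> \<le> norm (cnj u *\<^sub>C P y + V (P y))"
      using cmod_cinner_le[of _ z] z by (metis mult.right_neutral)
    finally have "((norm y)\<^sup>2)\<^sup>2 \<le> (norm (cnj u *\<^sub>C P y + V (P y)))\<^sup>2"
      by (intro power_mono) simp_all
    also have "\<dots> \<le> 2 * M * (norm y)\<^sup>2"
      by (rule adjoint_bound[OF u])
    finally have "(norm y)\<^sup>2 * (norm y)\<^sup>2 \<le> 2 * M * (norm y)\<^sup>2"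
      by (simp add: power2_eq_square)
    then show ?thesis
      using M unfolding y_def[symmetric]
      by (cases "y = 0") (simp_all only: mult_le_cancel_right, simp_all)
  qed
  have "cmod (cinner (A z) z) \<le> M / 2" if z: "norm z = 1" for z
  proof -
    \<comment> \<open>This rotation makes \<open>Re (u \<langle>A z, z\<rangle>)\<close> the full
      modulus, so the polarization bound applies to it.\<close>
    obtain u where u: "cmod u = 1" "u * cinner (A z) z = complex_of_real (cmod (cinner (A z) z))"
    proof (cases "cinner (A z) z = 0")
      case True
      then show ?thesis
        using that[of 1] by simp
    next
      case False
      let ?v = "cinner (A z) z"
      have "cnj ?v / cmod ?v * ?v = complex_of_real ((cmod ?v)\<^sup>2) / cmod ?v"
        by (simp add: complex_norm_square mult.commute del: of_real_power)
      then show ?thesis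
        using False by (intro that[of "cnj ?v / cmod ?v"]) (simp_all add: norm_divide power2_eq_square)
    qed
    have "cinner (A z) z = cinner (P z) (P (cadjoint V z))"
      by (metis AV cinner_cadjoint[OF clinV] positive_opD(2)[OF P])
    then have "cmod (cinner (A z) z) = (u *\<^sub>C P z) \<bullet> P (cadjoint V z)"
      by (metis Re_cinner Re_complex_of_real cinner_scaleC_left u(2))
    moreover have "4 * (s \<bullet> t) \<le> (norm (s + t))\<^sup>2" for s t :: 'a
      using zero_le_power2[of "norm (s - t)"]
      by (simp add: power2_norm_eq_inner inner_add_left inner_add_right inner_diff_left
          inner_diff_right inner_commute)
    ultimately have "4 * cmod (cinner (A z) z) \<le> 2 * M"
      using bound[OF u(1) z] by (metis order_trans)
    then show ?thesis
      by simp
  qed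
  then have "numerical_radius A \<le> M / 2"
    using M by (intro numerical_radius_le) simp_all
  then show ?thesis
    by (simp add: M_def T_def)
qed

section \<open>The quadratic form of the operator matrix in \<Delta>\<close>

theorem theorem2p7:
  fixes X :: "'a :: chilbert_space \<Rightarrow> 'a"
    and \<rho> \<nu> \<alpha> \<beta> :: real
  assumes "\<rho> \<in> {0<..2}"
    and "\<nu> \<in> {0..1}"
    and "\<alpha> = sqrt (8 * inverse \<rho> - 4)"
    and "\<beta> = 2 * inverse \<rho> - 2"
    and "bounded_clinear X"
  shows "Delta \<rho> \<nu> X \<le> (1 + \<bar>1 - 2 * \<nu>\<bar>) / 2 *
    (onorm (op_matrix (\<lambda>x. 0) (\<lambda>x. \<alpha> *\<^sub>R X x) (\<lambda>x. 0) (\<lambda>x. \<beta> *\<^sub>R X x)) +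
     numerical_radius (aluthge (op_matrix (\<lambda>x. 0) (\<lambda>x. \<alpha> *\<^sub>R X x) (\<lambda>x. 0) (\<lambda>x. \<beta> *\<^sub>R X x))))"
proof -
  note X = assms(5)
  define t where "t = 1 - 2 * \<nu>"
  define T where "T = op_matrix (\<lambda>x. 0) (\<lambda>x. \<alpha> *\<^sub>R X x) (\<lambda>x. 0) (\<lambda>x. \<beta> *\<^sub>R X x)"
  define D where "D = op_matrix (\<lambda>x. 0) (\<lambda>x. \<alpha> *\<^sub>R X x) (\<lambda>x. (\<alpha> * t) *\<^sub>R cadjoint X x)
    (\<lambda>x. \<beta> *\<^sub>R (X x + t *\<^sub>R cadjoint X x))"
  have T: "T = (\<lambda>z. (\<alpha> *\<^sub>R X (snd z), \<beta> *\<^sub>R X (snd z)))"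
    by (auto simp: T_def op_matrix_def fun_eq_iff)
  have "bounded_linear T"
    unfolding T
    by (intro bounded_linear_Pair bounded_linear_compose[OF bounded_linear_scaleR_right]
        bounded_linear_compose[OF bounded_clinearD(1)[OF X]] bounded_linear_snd)
  moreover have "T (c *\<^sub>C z) = c *\<^sub>C T z" for c z
    by (simp add: T scaleC_prod_def bounded_clinearD(2)[OF X]
        linear_scale[OF bounded_linear.linear[OF bounded_linear_scaleC]])
  ultimately have clinT: "bounded_clinear T"
    by (simp add: bounded_clinear_def)
  note linT = bounded_clinearD(1)[OF clinT]
  \<comment> \<open>Only the form of the adjoint of \<open>T\<close> matters, so the adjoint matrix
    is never built: each entry of \<open>D\<close> with \<open>cadjoint X\<close> contributes
    \<open>t\<close> times the conjugate of the term that the matching entry of \<open>T\<close>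
    contributes.\<close>
  have D: "cinner (D z) z = cinner (T z) z + t * cnj (cinner (T z) z)" for z
  proof -
    have "cinner (cadjoint X x) y = cnj (cinner (X y) x)" for x y
      by (metis cinner_cadjoint'[OF X] cinner_commute)
    then show ?thesis
      by (cases z) (simp add: D_def T op_matrix_def cinner_prod_def cinner_add_left
          cinner_scaleR_left scaleR_conv_of_real algebra_simps)
  qed
  have "numerical_radius D \<le> (1 + \<bar>t\<bar>) * numerical_radius T"
  proof (rule numerical_radius_le)
    show "0 \<le> (1 + \<bar>t\<bar>) * numerical_radius T"
      by (simp add: numerical_radius_nonneg[OF linT])
    fix z :: "'a \<times> 'a"
    assume "norm z = 1"
    then have *: "cmod (cinner (T z) z) \<le> numerical_radius T"
      using numerical_radius_bound[OF linT, of z] by simp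
    have "cmod (cinner (D z) z) \<le> cmod (cinner (T z) z) + cmod (t * cnj (cinner (T z) z))"
      unfolding D by (rule norm_triangle_ineq)
    also have "\<dots> = (1 + \<bar>t\<bar>) * cmod (cinner (T z) z)"
      by (simp add: norm_mult algebra_simps)
    also have "\<dots> \<le> (1 + \<bar>t\<bar>) * numerical_radius T"
      using * by (intro mult_left_mono) simp_all
    finally show "cmod (cinner (D z) z) \<le> (1 + \<bar>t\<bar>) * numerical_radius T" .
  qed
  also have "\<dots> \<le> (1 + \<bar>t\<bar>) * ((onorm T + numerical_radius (aluthge T)) / 2)"
    by (intro mult_left_mono numerical_radius_le_aluthge[OF clinT]) simp
  finally show ?thesis
    by (simp add: Delta_def Let_def D_def T_def t_def flip: assms(3,4))
qed

end
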